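(* Let $p$ be a prime number. Then the following conditions are equivalent for every function $f \colon \mathbb{R}^{+} \to \mathbb{R}^{+}$: (i) $f(0) = 0$ and the double inequality $0 < f(p^{m}) \leq 2 f(p^{n})$ holds whenever $m, n \in \mathbb{Z}$ and $m < n$. (ii) The function $f$ is $p$-adic metric preserving.
   Context: $\mathbb{R}^{+}$ denotes the set of all non-negative real numbers. For a prime $p$, $|\cdot|_p$ is the $p$-adic absolute value on the field $\mathbb{Q}_p$ of $p$-adic numbers, normalized so that $|0|_p = 0$ and $|x|_p = p^{-\operatorname{ord}_p x}$ for $x \neq 0$, and $d_p(x,y) = |x-y|_p$ is the $p$-adic metric on $\mathbb{Q}_p$. A function $f \colon \mathbb{R}^{+} \to \mathbb{R}^{+}$ is called $p$-adic metric preserving if the composition $f \circ d_p$ is a metric on $\mathbb{Q}_p$. *)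

theory Defs
  imports "HOL-Analysis.Abstract_Metric_Spaces" "HOL-Computational_Algebra.Primes"
    "HOL-Algebra.QuotRing"
begin

section \<open>The \<open>p\<close>-adic absolute value on the rational numbers\<close>

definition rat_ord :: "nat \<Rightarrow> rat \<Rightarrow> int" where
  "rat_ord p x = int (multiplicity (int p) (fst (quotient_of x)))
                 - int (multiplicity (int p) (snd (quotient_of x)))"

definition rat_padic_abs :: "nat \<Rightarrow> rat \<Rightarrow> real" where
  "rat_padic_abs p x = (if x = 0 then 0 else real p powi (- rat_ord p x))"


section \<open>The field of \<open>p\<close>-adic numbers\<close>

text \<open>
  The \<open>p\<close>-adic numbers are constructed as the completion of the rationals: Cauchy sequences
  modulo null sequences, both with respect to the \<open>p\<close>-adic absolute value.
\<close>

definition padic_Cauchy_seqs :: "nat \<Rightarrow> (nat \<Rightarrow> rat) set" where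
  "padic_Cauchy_seqs p =
     {s. \<forall>e>0. \<exists>N. \<forall>m\<ge>N. \<forall>n\<ge>N. rat_padic_abs p (s m - s n) < e}"

definition padic_null_seqs :: "nat \<Rightarrow> (nat \<Rightarrow> rat) set" where
  "padic_null_seqs p = {s. (\<lambda>n. rat_padic_abs p (s n)) \<longlonglongrightarrow> 0}"

definition padic_Cauchy_ring :: "nat \<Rightarrow> (nat \<Rightarrow> rat) ring" where
  "padic_Cauchy_ring p =
     \<lparr>carrier = padic_Cauchy_seqs p, mult = (\<lambda>s t n. s n * t n), one = (\<lambda>n. 1),
      zero = (\<lambda>n. 0), add = (\<lambda>s t n. s n + t n)\<rparr>"

definition padic_field :: "nat \<Rightarrow> (nat \<Rightarrow> rat) set ring" where
  "padic_field p = padic_Cauchy_ring p Quot padic_null_seqs p"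

text \<open>
  For a Cauchy sequence that is not a null sequence, the order of its terms is eventually constant,
  and this constant does not depend on the representative of the class; see
  \<open>padic_ord_exists\<close> and \<open>padic_ord_eqI\<close> below.
\<close>

definition padic_ord :: "nat \<Rightarrow> (nat \<Rightarrow> rat) set \<Rightarrow> int" where
  "padic_ord p x = (THE k. \<forall>s\<in>x. \<forall>\<^sub>F n in sequentially. s n \<noteq> 0 \<and> rat_ord p (s n) = k)"

definition padic_abs :: "nat \<Rightarrow> (nat \<Rightarrow> rat) set \<Rightarrow> real" where
  "padic_abs p x = (if x = \<zero>\<^bsub>padic_field p\<^esub> then 0 else real p powi (- padic_ord p x))"

text \<open>
  The locale \<^locale>\<open>Metric_space\<close> requires nonnegativity and symmetry also off the carrier,
  so the distance is given the dummy value 0 there.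
\<close>

definition padic_dist :: "nat \<Rightarrow> (nat \<Rightarrow> rat) set \<Rightarrow> (nat \<Rightarrow> rat) set \<Rightarrow> real" where
  "padic_dist p x y =
     (if x \<in> carrier (padic_field p) \<and> y \<in> carrier (padic_field p)
      then padic_abs p (x \<ominus>\<^bsub>padic_field p\<^esub> y) else 0)"

text \<open>
  This is meant for functions \<open>f\<close> that map \<open>{0..}\<close> to \<open>{0..}\<close>;
  the values of \<open>f\<close> at negative reals are irrelevant.
\<close>

definition padic_metric_preserving :: "nat \<Rightarrow> (real \<Rightarrow> real) \<Rightarrow> bool" where
  "padic_metric_preserving p f \<longleftrightarrow>
     Metric_space (carrier (padic_field p)) (\<lambda>x y. f (padic_dist p x y))"


section \<open>Well-definedness\<close>

context
  fixes p :: nat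
  assumes prime_p: "prime p"
begin

lemma prime_elem_p: "prime_elem (int p)"
  using prime_p by simp

lemma rat_ord_divide:
  fixes a b :: int
  assumes "a \<noteq> 0" "b \<noteq> 0"
  shows "rat_ord p (of_int a / of_int b)
         = int (multiplicity (int p) a) - int (multiplicity (int p) b)"
proof -
  obtain n d where q: "quotient_of (of_int a / of_int b) = (n, d)"
    by (cases "quotient_of (of_int a / of_int b)") auto
  have eq: "(of_int a / of_int b :: rat) = of_int n / of_int d"
    using quotient_of_div[OF q] .
  have d: "d > 0" using quotient_of_denom_pos[OF q] .
  have n: "n \<noteq> 0" using eq assms by auto
  have "(of_int (a * d) :: rat) = of_int (n * b)"
    using eq d assms by (simp add: field_simps)
  then have "a * d = n * b" by (simp only: of_int_eq_iff)
  then have "multiplicity (int p) (a * d) = multiplicity (int p) (n * b)" by simp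
  then have "multiplicity (int p) a + multiplicity (int p) d
             = multiplicity (int p) n + multiplicity (int p) b"
    using assms d n by (simp add: prime_elem_multiplicity_mult_distrib[OF prime_elem_p])
  then show ?thesis by (simp add: rat_ord_def q)
qed

lemma rat_common_denom:
  fixes x y :: rat
  obtains a b d :: int where "d \<noteq> 0" "x = of_int a / of_int d" "y = of_int b / of_int d"
proof -
  obtain n d where q: "quotient_of x = (n, d)" by (cases "quotient_of x") auto
  obtain m e where r: "quotient_of y = (m, e)" by (cases "quotient_of y") auto
  have "d > 0" "e > 0" using quotient_of_denom_pos[OF q] quotient_of_denom_pos[OF r] by auto
  moreover have "x = of_int n / of_int d" "y = of_int m / of_int e"
    using quotient_of_div[OF q] quotient_of_div[OF r] by auto
  ultimately show thesis
    by (intro that[of "d * e" "n * e" "m * d"]) auto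
qed

lemma p_gt_1: "real p > 1"
  using prime_gt_1_nat[OF prime_p] by simp

lemma rat_padic_abs_0 [simp]: "rat_padic_abs p 0 = 0"
  by (simp add: rat_padic_abs_def)

lemma rat_padic_abs_nonneg [simp]: "rat_padic_abs p x \<ge> 0"
  by (simp add: rat_padic_abs_def)

lemma rat_padic_abs_eq_0_iff [simp]: "rat_padic_abs p x = 0 \<longleftrightarrow> x = 0"
  using p_gt_1 by (simp add: rat_padic_abs_def)

lemma rat_padic_abs_1 [simp]: "rat_padic_abs p 1 = 1"
  using rat_ord_divide[of 1 1] by (simp add: rat_padic_abs_def)

lemma rat_ord_mult:
  assumes "x \<noteq> 0" "y \<noteq> 0"
  shows "rat_ord p (x * y) = rat_ord p x + rat_ord p y"
proof -
  obtain a b d where h: "d \<noteq> 0" "x = of_int a / of_int d" "y = of_int b / (of_int d :: rat)"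
    by (rule rat_common_denom)
  have ab: "a \<noteq> 0" "b \<noteq> 0" using h assms by auto
  have "x * y = of_int (a * b) / of_int (d * d)" using h by simp
  then have "rat_ord p (x * y)
      = int (multiplicity (int p) (a * b)) - int (multiplicity (int p) (d * d))"
    using rat_ord_divide[of "a * b" "d * d"] h ab by simp
  then show ?thesis
    using rat_ord_divide[of a d] rat_ord_divide[of b d] h ab
    by (simp add: prime_elem_multiplicity_mult_distrib[OF prime_elem_p])
qed

lemma rat_padic_abs_mult: "rat_padic_abs p (x * y) = rat_padic_abs p x * rat_padic_abs p y"
  using p_gt_1 power_int_add[of "real p" "- rat_ord p x" "- rat_ord p y"]
  by (simp add: rat_padic_abs_def rat_ord_mult)

lemma rat_padic_abs_minus [simp]: "rat_padic_abs p (- x) = rat_padic_abs p x"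
proof -
  have "rat_padic_abs p (-1) * rat_padic_abs p (-1) = 1"
    by (subst rat_padic_abs_mult[symmetric]) simp
  then have "(rat_padic_abs p (-1))\<^sup>2 = 1" by (simp add: power2_eq_square)
  then have "rat_padic_abs p (-1) = 1"
    using rat_padic_abs_nonneg[of "-1"] by (auto simp: power2_eq_1_iff simp del: rat_padic_abs_nonneg)
  then show ?thesis using rat_padic_abs_mult[of "-1" x] by simp
qed

lemma rat_padic_abs_diff_commute: "rat_padic_abs p (x - y) = rat_padic_abs p (y - x)"
  using rat_padic_abs_minus[of "x - y"] by simp

lemma rat_padic_abs_ultra:
  "rat_padic_abs p (x + y) \<le> max (rat_padic_abs p x) (rat_padic_abs p y)"
proof (cases "x = 0 \<or> y = 0 \<or> x + y = 0")
  case True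
  then show ?thesis by (auto simp: max_def)
next
  case False
  obtain a b d where h: "d \<noteq> 0" "x = of_int a / of_int d" "y = of_int b / (of_int d :: rat)"
    by (rule rat_common_denom)
  have xy: "x + y = of_int (a + b) / of_int d" using h by (simp add: add_divide_distrib)
  have ab: "a \<noteq> 0" "b \<noteq> 0" "a + b \<noteq> 0" using False h xy by auto
  let ?k = "min (multiplicity (int p) a) (multiplicity (int p) b)"
  have "int p ^ ?k dvd a + b"
    by (intro dvd_add multiplicity_dvd') auto
  then have "?k \<le> multiplicity (int p) (a + b)"
    using ab prime_elem_p by (intro multiplicity_geI) auto
  then have "min (rat_ord p x) (rat_ord p y) \<le> rat_ord p (x + y)"
    using rat_ord_divide[of a d] rat_ord_divide[of b d] rat_ord_divide[of "a + b" d] h ab xy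
    by auto
  then have "- rat_ord p (x + y) \<le> - rat_ord p x \<or> - rat_ord p (x + y) \<le> - rat_ord p y"
    by linarith
  then show ?thesis
    using False p_gt_1 by (auto simp: rat_padic_abs_def le_max_iff_disj intro: power_int_increasing)
qed

lemma rat_padic_abs_add_le:
  "rat_padic_abs p (x + y) \<le> rat_padic_abs p x + rat_padic_abs p y"
  using rat_padic_abs_ultra[of x y] rat_padic_abs_nonneg[of x] rat_padic_abs_nonneg[of y]
  by linarith

lemma rat_padic_abs_add_eq:
  assumes "rat_padic_abs p y < rat_padic_abs p x"
  shows "rat_padic_abs p (x + y) = rat_padic_abs p x"
  using rat_padic_abs_ultra[of x y] rat_padic_abs_ultra[of "x + y" "- y"] assms by simp

lemma rat_ord_eq_iff:
  assumes "x \<noteq> 0" "y \<noteq> 0"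
  shows "rat_ord p x = rat_ord p y \<longleftrightarrow> rat_padic_abs p x = rat_padic_abs p y"
  using assms p_gt_1 power_int_strict_increasing[of "- rat_ord p x" "- rat_ord p y" "real p"]
    power_int_strict_increasing[of "- rat_ord p y" "- rat_ord p x" "real p"]
  by (cases "rat_ord p x" "rat_ord p y" rule: linorder_cases) (auto simp: rat_padic_abs_def)

lemma Cauchy_seqsD:
  assumes "s \<in> padic_Cauchy_seqs p" "e > 0"
  obtains N where "\<And>m n. m \<ge> N \<Longrightarrow> n \<ge> N \<Longrightarrow> rat_padic_abs p (s m - s n) < e"
  using assms unfolding padic_Cauchy_seqs_def by blast

lemma null_seqs_iff:
  "s \<in> padic_null_seqs p \<longleftrightarrow> (\<forall>e>0. \<exists>N. \<forall>n\<ge>N. rat_padic_abs p (s n) < e)"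
  unfolding padic_null_seqs_def by (simp add: LIMSEQ_iff)

lemma null_seqsD:
  assumes "s \<in> padic_null_seqs p" "e > 0"
  obtains N where "\<And>n. n \<ge> N \<Longrightarrow> rat_padic_abs p (s n) < e"
  using assms unfolding null_seqs_iff by blast

lemma Cauchy_nonnull_eventually_const:
  assumes s: "s \<in> padic_Cauchy_seqs p" and nn: "s \<notin> padic_null_seqs p"
  obtains N c where "c > 0" "\<And>n. n \<ge> N \<Longrightarrow> rat_padic_abs p (s n) = c"
proof -
  obtain e where e: "e > 0" "\<And>N. \<exists>n\<ge>N. rat_padic_abs p (s n) \<ge> e"
    using nn unfolding null_seqs_iff by (auto simp: not_less)
  obtain N where N: "\<And>m n. m \<ge> N \<Longrightarrow> n \<ge> N \<Longrightarrow> rat_padic_abs p (s m - s n) < e"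
    using Cauchy_seqsD[OF s e(1)] by blast
  obtain k where k: "k \<ge> N" "rat_padic_abs p (s k) \<ge> e" using e(2) by blast
  have "rat_padic_abs p (s n) = rat_padic_abs p (s k)" if "n \<ge> N" for n
    using rat_padic_abs_add_eq[of "s n - s k" "s k"] N[OF that k(1)] k(2) by simp
  then show thesis using e(1) k(2) by (intro that[of "rat_padic_abs p (s k)" N]) auto
qed

lemma Cauchy_seqs_bounded:
  assumes s: "s \<in> padic_Cauchy_seqs p"
  obtains B N where "B > 0" "\<And>n. n \<ge> N \<Longrightarrow> rat_padic_abs p (s n) \<le> B"
proof (cases "s \<in> padic_null_seqs p")
  case True
  then obtain N where "\<And>n. n \<ge> N \<Longrightarrow> rat_padic_abs p (s n) < 1"
    using null_seqsD[of s 1] by auto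
  then show ?thesis using that[of 1 N] by force
next
  case False
  then show ?thesis using Cauchy_nonnull_eventually_const[OF s] that by (metis order_refl)
qed

lemma null_seqs_subset: "padic_null_seqs p \<subseteq> padic_Cauchy_seqs p"
proof
  fix s assume s: "s \<in> padic_null_seqs p"
  show "s \<in> padic_Cauchy_seqs p"
    unfolding padic_Cauchy_seqs_def
  proof (intro CollectI allI impI)
    fix e :: real assume "e > 0"
    then obtain N where N: "\<And>n. n \<ge> N \<Longrightarrow> rat_padic_abs p (s n) < e"
      using null_seqsD[OF s] by blast
    have "rat_padic_abs p (s m - s n) < e" if "m \<ge> N" "n \<ge> N" for m n
      using rat_padic_abs_ultra[of "s m" "- s n"] N[OF that(1)] N[OF that(2)] by simp
    then show "\<exists>N. \<forall>m\<ge>N. \<forall>n\<ge>N. rat_padic_abs p (s m - s n) < e" by blast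
  qed
qed

lemma const_Cauchy: "(\<lambda>n. c) \<in> padic_Cauchy_seqs p"
  by (simp add: padic_Cauchy_seqs_def)

lemma uminus_Cauchy: "s \<in> padic_Cauchy_seqs p \<Longrightarrow> (\<lambda>n. - s n) \<in> padic_Cauchy_seqs p"
  unfolding padic_Cauchy_seqs_def
  by (simp add: rat_padic_abs_diff_commute)

lemma add_Cauchy:
  assumes s: "s \<in> padic_Cauchy_seqs p" and t: "t \<in> padic_Cauchy_seqs p"
  shows "(\<lambda>n. s n + t n) \<in> padic_Cauchy_seqs p"
  unfolding padic_Cauchy_seqs_def
proof (intro CollectI allI impI)
  fix e :: real assume e: "e > 0"
  obtain N where N: "\<And>m n. m \<ge> N \<Longrightarrow> n \<ge> N \<Longrightarrow> rat_padic_abs p (s m - s n) < e"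
    using Cauchy_seqsD[OF s e] by blast
  obtain M where M: "\<And>m n. m \<ge> M \<Longrightarrow> n \<ge> M \<Longrightarrow> rat_padic_abs p (t m - t n) < e"
    using Cauchy_seqsD[OF t e] by blast
  have "rat_padic_abs p ((s m + t m) - (s n + t n)) < e" if "m \<ge> max N M" "n \<ge> max N M" for m n
  proof -
    have "(s m + t m) - (s n + t n) = (s m - s n) + (t m - t n)" by simp
    then show ?thesis
      using rat_padic_abs_ultra[of "s m - s n" "t m - t n"] N[of m n] M[of m n] that
      by (metis max.bounded_iff max_less_iff_conj order_le_less_trans)
  qed
  then show "\<exists>N. \<forall>m\<ge>N. \<forall>n\<ge>N. rat_padic_abs p ((s m + t m) - (s n + t n)) < e" by blast
qed

lemma mult_Cauchy:
  assumes s: "s \<in> padic_Cauchy_seqs p" and t: "t \<in> padic_Cauchy_seqs p"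
  shows "(\<lambda>n. s n * t n) \<in> padic_Cauchy_seqs p"
  unfolding padic_Cauchy_seqs_def
proof (intro CollectI allI impI)
  fix e :: real assume e: "e > 0"
  obtain B K where B: "B > 0" "\<And>n. n \<ge> K \<Longrightarrow> rat_padic_abs p (s n) \<le> B"
    using Cauchy_seqs_bounded[OF s] by blast
  obtain C L where C: "C > 0" "\<And>n. n \<ge> L \<Longrightarrow> rat_padic_abs p (t n) \<le> C"
    using Cauchy_seqs_bounded[OF t] by blast
  obtain N where N: "\<And>m n. m \<ge> N \<Longrightarrow> n \<ge> N \<Longrightarrow> rat_padic_abs p (s m - s n) < e / C"
    using Cauchy_seqsD[OF s, of "e / C"] e C by auto
  obtain M where M: "\<And>m n. m \<ge> M \<Longrightarrow> n \<ge> M \<Longrightarrow> rat_padic_abs p (t m - t n) < e / B"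
    using Cauchy_seqsD[OF t, of "e / B"] e B by auto
  define P where "P = max (max K L) (max N M)"
  have "rat_padic_abs p (s m * t m - s n * t n) < e" if "m \<ge> P" "n \<ge> P" for m n
  proof -
    have eq: "s m * t m - s n * t n = s m * (t m - t n) + (s m - s n) * t n"
      by (simp add: algebra_simps)
    have "rat_padic_abs p (s m * (t m - t n)) \<le> B * rat_padic_abs p (t m - t n)"
      using B(2)[of m] that by (simp add: rat_padic_abs_mult P_def mult_right_mono)
    also have "\<dots> < B * (e / B)" using M[of m n] B that by (intro mult_strict_left_mono) (auto simp: P_def)
    also have "\<dots> = e" using B by simp
    finally have 1: "rat_padic_abs p (s m * (t m - t n)) < e" .
    have "rat_padic_abs p ((s m - s n) * t n) \<le> rat_padic_abs p (s m - s n) * C"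
      using C(2)[of n] that by (simp add: rat_padic_abs_mult P_def mult_left_mono)
    also have "\<dots> < e / C * C" using N[of m n] C that by (intro mult_strict_right_mono) (auto simp: P_def)
    also have "\<dots> = e" using C by simp
    finally have 2: "rat_padic_abs p ((s m - s n) * t n) < e" .
    show ?thesis
      unfolding eq using rat_padic_abs_ultra[of "s m * (t m - t n)" "(s m - s n) * t n"] 1 2 by linarith
  qed
  then show "\<exists>N. \<forall>m\<ge>N. \<forall>n\<ge>N. rat_padic_abs p (s m * t m - s n * t n) < e" by blast
qed

lemma add_null:
  assumes "s \<in> padic_null_seqs p" "t \<in> padic_null_seqs p"
  shows "(\<lambda>n. s n + t n) \<in> padic_null_seqs p"
proof -
  have "(\<lambda>n. rat_padic_abs p (s n) + rat_padic_abs p (t n)) \<longlonglongrightarrow> 0"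
    using assms tendsto_add unfolding padic_null_seqs_def by fastforce
  then show ?thesis unfolding padic_null_seqs_def mem_Collect_eq
    by (rule tendsto_sandwich[OF _ _ tendsto_const, rotated -1]) (auto intro!: always_eventually rat_padic_abs_add_le)
qed

lemma uminus_null: "s \<in> padic_null_seqs p \<Longrightarrow> (\<lambda>n. - s n) \<in> padic_null_seqs p"
  by (simp add: padic_null_seqs_def)

lemma mult_null:
  assumes s: "s \<in> padic_null_seqs p" and t: "t \<in> padic_Cauchy_seqs p"
  shows "(\<lambda>n. s n * t n) \<in> padic_null_seqs p"
proof -
  obtain B N where B: "B > 0" "\<And>n. n \<ge> N \<Longrightarrow> rat_padic_abs p (t n) \<le> B"
    using Cauchy_seqs_bounded[OF t] by blast
  have lim: "(\<lambda>n. rat_padic_abs p (s n) * B) \<longlonglongrightarrow> 0"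
    using s unfolding padic_null_seqs_def by (auto intro: tendsto_mult_left_zero)
  have "\<forall>\<^sub>F n in sequentially. rat_padic_abs p (s n * t n) \<le> rat_padic_abs p (s n) * B"
    using B by (auto simp: eventually_sequentially rat_padic_abs_mult intro!: exI[of _ N] mult_left_mono)
  then show ?thesis unfolding padic_null_seqs_def mem_Collect_eq
    by (intro tendsto_sandwich[OF _ _ tendsto_const lim]) auto
qed

lemma cring_padic_Cauchy_ring: "cring (padic_Cauchy_ring p)"
proof (rule cringI)
  show "abelian_group (padic_Cauchy_ring p)"
  proof (rule abelian_groupI)
    fix s assume "s \<in> carrier (padic_Cauchy_ring p)"
    then show "\<exists>t\<in>carrier (padic_Cauchy_ring p). t \<oplus>\<^bsub>padic_Cauchy_ring p\<^esub> s = \<zero>\<^bsub>padic_Cauchy_ring p\<^esub>"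
      by (intro bexI[of _ "\<lambda>n. - s n"]) (auto simp: padic_Cauchy_ring_def uminus_Cauchy)
  qed (auto simp: padic_Cauchy_ring_def add_Cauchy const_Cauchy add_ac)
  show "comm_monoid (padic_Cauchy_ring p)"
    by unfold_locales (auto simp: padic_Cauchy_ring_def mult_Cauchy const_Cauchy mult_ac)
qed (auto simp: padic_Cauchy_ring_def algebra_simps)

lemma padic_Cauchy_ring_uminus:
  assumes "s \<in> padic_Cauchy_seqs p"
  shows "\<ominus>\<^bsub>padic_Cauchy_ring p\<^esub> s = (\<lambda>n. - s n)"
proof -
  interpret cring "padic_Cauchy_ring p" by (rule cring_padic_Cauchy_ring)
  show ?thesis
    by (rule minus_equality) (use assms in \<open>auto simp: padic_Cauchy_ring_def uminus_Cauchy\<close>)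
qed

lemma ideal_padic_null_seqs: "ideal (padic_null_seqs p) (padic_Cauchy_ring p)"
proof -
  interpret cring "padic_Cauchy_ring p" by (rule cring_padic_Cauchy_ring)
  have carr: "carrier (padic_Cauchy_ring p) = padic_Cauchy_seqs p"
    by (simp add: padic_Cauchy_ring_def)
  show ?thesis
  proof (rule idealI)
    show "ring (padic_Cauchy_ring p)" by (rule ring_axioms)
    show "subgroup (padic_null_seqs p) (add_monoid (padic_Cauchy_ring p))"
    proof (rule group.subgroupI)
      show "group (add_monoid (padic_Cauchy_ring p))" using is_abelian_group abelian_group.a_group by blast
      show "padic_null_seqs p \<subseteq> carrier (add_monoid (padic_Cauchy_ring p))"
        using null_seqs_subset carr by simp
      show "padic_null_seqs p \<noteq> {}"
        using null_seqs_iff[of "\<lambda>n. 0"] by auto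
    next
      fix s assume s: "s \<in> padic_null_seqs p"
      then have "\<ominus>\<^bsub>padic_Cauchy_ring p\<^esub> s \<in> padic_null_seqs p"
        using padic_Cauchy_ring_uminus null_seqs_subset uminus_null by auto
      then show "inv\<^bsub>add_monoid (padic_Cauchy_ring p)\<^esub> s \<in> padic_null_seqs p"
        by (simp add: a_inv_def)
    qed (auto simp: padic_Cauchy_ring_def add_null)
  next
    fix s t assume st: "s \<in> padic_null_seqs p" "t \<in> carrier (padic_Cauchy_ring p)"
    show "s \<otimes>\<^bsub>padic_Cauchy_ring p\<^esub> t \<in> padic_null_seqs p"
      using mult_null[of s t] st by (simp add: padic_Cauchy_ring_def)
    show "t \<otimes>\<^bsub>padic_Cauchy_ring p\<^esub> s \<in> padic_null_seqs p"
      using mult_null[of s t] st by (simp add: padic_Cauchy_ring_def mult.commute)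
  qed
qed

lemma carrier_padic_field:
  "carrier (padic_field p)
   = (\<lambda>s. padic_null_seqs p +>\<^bsub>padic_Cauchy_ring p\<^esub> s) ` padic_Cauchy_seqs p"
  by (auto simp: padic_field_def FactRing_def A_RCOSETS_def' padic_Cauchy_ring_def)

lemma mem_coset_iff:
  "t \<in> padic_null_seqs p +>\<^bsub>padic_Cauchy_ring p\<^esub> s \<longleftrightarrow> (\<lambda>n. t n - s n) \<in> padic_null_seqs p"
proof
  assume "t \<in> padic_null_seqs p +>\<^bsub>padic_Cauchy_ring p\<^esub> s"
  then show "(\<lambda>n. t n - s n) \<in> padic_null_seqs p"
    by (auto simp: a_r_coset_def' padic_Cauchy_ring_def)
next
  assume *: "(\<lambda>n. t n - s n) \<in> padic_null_seqs p"
  show "t \<in> padic_null_seqs p +>\<^bsub>padic_Cauchy_ring p\<^esub> s"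
    unfolding a_r_coset_def' by (rule UN_I[OF *]) (simp add: padic_Cauchy_ring_def)
qed

lemma coset_eq_iff:
  assumes "s \<in> padic_Cauchy_seqs p" "t \<in> padic_Cauchy_seqs p"
  shows "padic_null_seqs p +>\<^bsub>padic_Cauchy_ring p\<^esub> s = padic_null_seqs p +>\<^bsub>padic_Cauchy_ring p\<^esub> t
         \<longleftrightarrow> (\<lambda>n. s n - t n) \<in> padic_null_seqs p" (is "?S = ?T \<longleftrightarrow> _")
proof
  assume "?S = ?T"
  moreover have "s \<in> ?S" by (simp add: mem_coset_iff null_seqs_iff)
  ultimately show "(\<lambda>n. s n - t n) \<in> padic_null_seqs p" by (simp add: mem_coset_iff)
next
  assume *: "(\<lambda>n. s n - t n) \<in> padic_null_seqs p"
  have "u \<in> ?S \<longleftrightarrow> u \<in> ?T" for u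
    using add_null[OF _ *, of "\<lambda>n. u n - s n"] add_null[OF _ uminus_null[OF *], of "\<lambda>n. u n - t n"]
    by (auto simp: mem_coset_iff)
  then show "?S = ?T" by blast
qed

lemma zero_padic_field: "\<zero>\<^bsub>padic_field p\<^esub> = padic_null_seqs p"
  by (simp add: padic_field_def FactRing_def)

lemma zero_padic_field_coset:
  "\<zero>\<^bsub>padic_field p\<^esub> = padic_null_seqs p +>\<^bsub>padic_Cauchy_ring p\<^esub> (\<lambda>n. 0)"
  by (auto simp: zero_padic_field mem_coset_iff)

theorem field_padic_field: "field (padic_field p)"
proof -
  interpret R: cring "padic_Cauchy_ring p" by (rule cring_padic_Cauchy_ring)
  interpret I: ideal "padic_null_seqs p" "padic_Cauchy_ring p" by (rule ideal_padic_null_seqs)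
  interpret Q: cring "padic_field p"
    unfolding padic_field_def by (rule I.quotient_is_cring[OF R.is_cring])
  have carr: "carrier (padic_Cauchy_ring p) = padic_Cauchy_seqs p"
    by (simp add: padic_Cauchy_ring_def)
  have one: "\<one>\<^bsub>padic_field p\<^esub> = padic_null_seqs p +>\<^bsub>padic_Cauchy_ring p\<^esub> (\<lambda>n. 1)"
    by (simp add: padic_field_def FactRing_def) (simp add: padic_Cauchy_ring_def)
  show ?thesis
  proof (rule Q.cring_fieldI2)
    show "\<zero>\<^bsub>padic_field p\<^esub> \<noteq> \<one>\<^bsub>padic_field p\<^esub>"
    proof
      assume "\<zero>\<^bsub>padic_field p\<^esub> = \<one>\<^bsub>padic_field p\<^esub>"
      then have "(\<lambda>n. 1) \<in> padic_null_seqs p"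
        unfolding one zero_padic_field_coset
        by (subst (asm) coset_eq_iff) (auto simp: const_Cauchy dest: uminus_null)
      then show False by (simp add: padic_null_seqs_def LIMSEQ_const_iff)
    qed
  next
    fix x assume x: "x \<in> carrier (padic_field p)" "x \<noteq> \<zero>\<^bsub>padic_field p\<^esub>"
    obtain s where s: "s \<in> padic_Cauchy_seqs p"
      and xs: "x = padic_null_seqs p +>\<^bsub>padic_Cauchy_ring p\<^esub> s"
      using x(1) unfolding carrier_padic_field by blast
    have "s \<notin> padic_null_seqs p"
      using x(2) coset_eq_iff[OF s const_Cauchy[of 0]] unfolding xs zero_padic_field_coset by simp
    then obtain N c where c: "c > 0" "\<And>n. n \<ge> N \<Longrightarrow> rat_padic_abs p (s n) = c"
      using Cauchy_nonnull_eventually_const[OF s] by blast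
    have nz: "s n \<noteq> 0" if "n \<ge> N" for n using c that by force
    define t where "t = (\<lambda>n. inverse (s n))"
    have t: "t \<in> padic_Cauchy_seqs p"
      unfolding padic_Cauchy_seqs_def
    proof (intro CollectI allI impI)
      fix e :: real assume "e > 0"
      then obtain M where M: "\<And>m n. m \<ge> M \<Longrightarrow> n \<ge> M \<Longrightarrow> rat_padic_abs p (s m - s n) < e * (c * c)"
        using Cauchy_seqsD[OF s, of "e * (c * c)"] c by auto
      have "rat_padic_abs p (t m - t n) < e" if "m \<ge> max N M" "n \<ge> max N M" for m n
      proof -
        have "s n - s m = (t m - t n) * (s m * s n)"
          using nz[of m] nz[of n] that by (simp add: t_def field_simps)
        then have "rat_padic_abs p (s n - s m) = rat_padic_abs p (t m - t n) * (c * c)"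
          using c(2)[of m] c(2)[of n] that by (simp add: rat_padic_abs_mult)
        then show ?thesis using M[of n m] that c(1) by simp
      qed
      then show "\<exists>N. \<forall>m\<ge>N. \<forall>n\<ge>N. rat_padic_abs p (t m - t n) < e" by blast
    qed
    let ?y = "padic_null_seqs p +>\<^bsub>padic_Cauchy_ring p\<^esub> t"
    have "x \<otimes>\<^bsub>padic_field p\<^esub> ?y
        = padic_null_seqs p +>\<^bsub>padic_Cauchy_ring p\<^esub> (s \<otimes>\<^bsub>padic_Cauchy_ring p\<^esub> t)"
      unfolding xs padic_field_def FactRing_def
      using I.rcoset_mult_add[of s t] s t by (simp add: carr)
    also have "\<dots> = padic_null_seqs p +>\<^bsub>padic_Cauchy_ring p\<^esub> (\<lambda>n. s n * t n)"
      by (simp add: padic_Cauchy_ring_def)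
    also have "\<dots> = \<one>\<^bsub>padic_field p\<^esub>"
    proof -
      have "\<forall>n\<ge>N. s n * t n - 1 = 0" using nz by (simp add: t_def)
      then have "(\<lambda>n. s n * t n - 1) \<in> padic_null_seqs p"
        unfolding null_seqs_iff by (metis rat_padic_abs_0)
      then show ?thesis
        unfolding one using coset_eq_iff[OF mult_Cauchy[OF s t] const_Cauchy[of 1]] by simp
    qed
    finally show "\<exists>y\<in>carrier (padic_field p). x \<otimes>\<^bsub>padic_field p\<^esub> y = \<one>\<^bsub>padic_field p\<^esub>"
      using t unfolding carrier_padic_field by blast
  qed
qed

lemma padic_ord_exists:
  assumes "x \<in> carrier (padic_field p)" "x \<noteq> \<zero>\<^bsub>padic_field p\<^esub>"
  shows "\<exists>k. \<forall>s\<in>x. \<forall>\<^sub>F n in sequentially. s n \<noteq> 0 \<and> rat_ord p (s n) = k"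
proof -
  obtain s where s: "s \<in> padic_Cauchy_seqs p"
    and xs: "x = padic_null_seqs p +>\<^bsub>padic_Cauchy_ring p\<^esub> s"
    using assms(1) unfolding carrier_padic_field by blast
  have "s \<notin> padic_null_seqs p"
    using assms(2) coset_eq_iff[OF s const_Cauchy[of 0]] unfolding xs zero_padic_field_coset by simp
  then obtain N c where c: "c > 0" "\<And>n. n \<ge> N \<Longrightarrow> rat_padic_abs p (s n) = c"
    using Cauchy_nonnull_eventually_const[OF s] by blast
  have sN: "s N \<noteq> 0" using c by force
  have "\<forall>\<^sub>F n in sequentially. t n \<noteq> 0 \<and> rat_ord p (t n) = rat_ord p (s N)" if "t \<in> x" for t
  proof -
    have "(\<lambda>n. t n - s n) \<in> padic_null_seqs p"
      using that unfolding xs mem_coset_iff .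
    then obtain M where M: "\<And>n. n \<ge> M \<Longrightarrow> rat_padic_abs p (t n - s n) < c"
      using null_seqsD c(1) by blast
    have "t n \<noteq> 0 \<and> rat_ord p (t n) = rat_ord p (s N)" if n: "n \<ge> max N M" for n
    proof -
      have "rat_padic_abs p (t n) = c"
        using rat_padic_abs_add_eq[of "t n - s n" "s n"] c(2)[of n] M[of n] n by simp
      then show ?thesis
        using c(1) c(2)[of N] sN rat_ord_eq_iff[of "t n" "s N"] by force
    qed
    then show ?thesis unfolding eventually_sequentially by blast
  qed
  then show ?thesis by blast
qed

lemma padic_ord_eqI:
  assumes "x \<in> carrier (padic_field p)" "x \<noteq> \<zero>\<^bsub>padic_field p\<^esub>" "s \<in> x"
    and "\<forall>\<^sub>F n in sequentially. rat_ord p (s n) = k"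
  shows "padic_ord p x = k"
proof -
  obtain l where l: "\<And>t. t \<in> x \<Longrightarrow> \<forall>\<^sub>F n in sequentially. t n \<noteq> 0 \<and> rat_ord p (t n) = l"
    using padic_ord_exists[OF assms(1,2)] by blast
  have unique: "j = k" if "\<forall>\<^sub>F n in sequentially. s n \<noteq> 0 \<and> rat_ord p (s n) = j" for j
    using eventually_happens'[OF sequentially_bot eventually_conj[OF that assms(4)]] by auto
  have "l = k" using unique l[OF assms(3)] by blast
  show ?thesis unfolding padic_ord_def
  proof (rule the_equality)
    show "\<forall>t\<in>x. \<forall>\<^sub>F n in sequentially. t n \<noteq> 0 \<and> rat_ord p (t n) = k"
      using l \<open>l = k\<close> by blast
  qed (use unique assms(3) in blast)
qed

lemma padic_abs_of_rat:
  "padic_abs p (padic_null_seqs p +>\<^bsub>padic_Cauchy_ring p\<^esub> (\<lambda>n. q)) = rat_padic_abs p q"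
  (is "padic_abs p ?x = _")
proof -
  have x: "?x \<in> carrier (padic_field p)"
    unfolding carrier_padic_field using const_Cauchy by blast
  have mem: "(\<lambda>n. q) \<in> ?x" by (simp add: mem_coset_iff null_seqs_iff)
  have zero: "?x = \<zero>\<^bsub>padic_field p\<^esub> \<longleftrightarrow> q = 0"
    unfolding zero_padic_field_coset coset_eq_iff[OF const_Cauchy const_Cauchy]
    by (simp add: padic_null_seqs_def LIMSEQ_const_iff)
  show ?thesis
    using padic_ord_eqI[OF x _ mem, of "rat_ord p q"] zero
    by (simp add: padic_abs_def rat_padic_abs_def)
qed

end

end

theory Submission
  imports Defs
begin

text \<open>
  The nonzero distances in \<open>\<rat>\<^sub>p\<close> are the integer powers of \<open>p\<close>, and \<open>d\<^sub>p\<close> is an ultrametric,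
  so every triangle is isosceles with its base no longer than its two equal legs. Conversely, for
  \<open>m < n\<close> the points \<open>0\<close>, \<open>p\<^sup>-\<^sup>n\<close> and \<open>p\<^sup>-\<^sup>n + p\<^sup>-\<^sup>m\<close> form a triangle with legs \<open>p\<^sup>n\<close> and base \<open>p\<^sup>m\<close>. For
  a triangle with legs \<open>a\<close> and base \<open>c\<close> the triangle inequalities after applying \<open>f\<close> read
  \<open>f a \<le> f a + f c\<close>, which is trivial, and \<open>f c \<le> 2 * f a\<close>. The latter is trivial for \<open>c = a\<close> and \<open>c = 0\<close>;
  for \<open>0 < c < a\<close> it is exactly the inequality on powers of \<open>p\<close>. Positivity of \<open>f\<close> on the powers of \<open>p\<close>
  together with \<open>f 0 = 0\<close> says that distinct points keep a nonzero distance and that points keep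
  distance zero to themselves.

  The facts about \<open>d\<^sub>p\<close> are carried over from the rationals by continuity: the distance of two classes
  of Cauchy sequences is the limit of the termwise distances (\<open>tendsto_padic_dist\<close>).
\<close>

context
  fixes p :: nat
  assumes prime_p: "prime p"
begin

abbreviation padic_class :: "(nat \<Rightarrow> rat) \<Rightarrow> (nat \<Rightarrow> rat) set" where
  "padic_class s \<equiv> padic_null_seqs p +>\<^bsub>padic_Cauchy_ring p\<^esub> s"

section \<open>The distance of two classes as a limit\<close>

lemma padic_class_diff:
  assumes s: "s \<in> padic_Cauchy_seqs p" and t: "t \<in> padic_Cauchy_seqs p"
  shows "padic_class s \<ominus>\<^bsub>padic_field p\<^esub> padic_class t = padic_class (\<lambda>n. s n - t n)"
proof -
  interpret R: cring "padic_Cauchy_ring p" by (rule cring_padic_Cauchy_ring[OF prime_p])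
  interpret I: ideal "padic_null_seqs p" "padic_Cauchy_ring p"
    by (rule ideal_padic_null_seqs[OF prime_p])
  interpret H: ring_hom_ring "padic_Cauchy_ring p" "padic_field p" padic_class
    unfolding padic_field_def by (rule I.rcos_ring_hom_ring)
  have carr: "carrier (padic_Cauchy_ring p) = padic_Cauchy_seqs p"
    by (simp add: padic_Cauchy_ring_def)
  have "padic_class s \<ominus>\<^bsub>padic_field p\<^esub> padic_class t
        = padic_class (s \<oplus>\<^bsub>padic_Cauchy_ring p\<^esub> \<ominus>\<^bsub>padic_Cauchy_ring p\<^esub> t)"
    unfolding a_minus_def
    by (subst H.hom_add, use s t carr H.hom_a_inv[of t] R.a_inv_closed[of t] in simp_all)
  also have "s \<oplus>\<^bsub>padic_Cauchy_ring p\<^esub> \<ominus>\<^bsub>padic_Cauchy_ring p\<^esub> t = (\<lambda>n. s n - t n)"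
    unfolding padic_Cauchy_ring_uminus[OF prime_p t] by (simp add: padic_Cauchy_ring_def)
  finally show ?thesis .
qed

lemma diff_Cauchy:
  assumes "s \<in> padic_Cauchy_seqs p" "t \<in> padic_Cauchy_seqs p"
  shows "(\<lambda>n. s n - t n) \<in> padic_Cauchy_seqs p"
  using add_Cauchy[OF prime_p assms(1) uminus_Cauchy[OF prime_p assms(2)]] by simp

lemma padic_class_in_carrier:
  "s \<in> padic_Cauchy_seqs p \<Longrightarrow> padic_class s \<in> carrier (padic_field p)"
  by (simp add: carrier_padic_field[OF prime_p])

lemma padic_class_eq_zero_iff:
  assumes "s \<in> padic_Cauchy_seqs p"
  shows "padic_class s = \<zero>\<^bsub>padic_field p\<^esub> \<longleftrightarrow> s \<in> padic_null_seqs p"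
  unfolding zero_padic_field_coset[OF prime_p]
    coset_eq_iff[OF prime_p assms const_Cauchy[OF prime_p]] by simp

text \<open>
  A null sequence represents \<open>0\<close>; for any other Cauchy sequence the order of the terms is eventually
  constant, equal to the order of the class, so that the absolute values are eventually constant too.
\<close>

lemma tendsto_padic_abs:
  assumes s: "s \<in> padic_Cauchy_seqs p"
  shows "(\<lambda>n. rat_padic_abs p (s n)) \<longlonglongrightarrow> padic_abs p (padic_class s)"
proof (cases "s \<in> padic_null_seqs p")
  case True
  then show ?thesis
    using padic_class_eq_zero_iff[OF s] by (simp add: padic_abs_def padic_null_seqs_def)
next
  case False
  then have nz: "padic_class s \<noteq> \<zero>\<^bsub>padic_field p\<^esub>"
    using padic_class_eq_zero_iff[OF s] by simp
  have mem: "s \<in> padic_class s"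
    by (simp add: mem_coset_iff[OF prime_p] null_seqs_iff[OF prime_p] rat_padic_abs_def)
  obtain k where k: "\<forall>\<^sub>F n in sequentially. s n \<noteq> 0 \<and> rat_ord p (s n) = k"
    using padic_ord_exists[OF prime_p padic_class_in_carrier[OF s] nz] mem by blast
  have "padic_ord p (padic_class s) = k"
    by (rule padic_ord_eqI[OF prime_p padic_class_in_carrier[OF s] nz mem])
       (use k in \<open>auto elim: eventually_mono\<close>)
  then have "\<forall>\<^sub>F n in sequentially. rat_padic_abs p (s n) = padic_abs p (padic_class s)"
    using k nz by (auto elim!: eventually_mono simp: padic_abs_def rat_padic_abs_def)
  then show ?thesis by (rule tendsto_eventually)
qed

lemma tendsto_padic_dist:
  assumes "s \<in> padic_Cauchy_seqs p" "t \<in> padic_Cauchy_seqs p"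
  shows "(\<lambda>n. rat_padic_abs p (s n - t n)) \<longlonglongrightarrow> padic_dist p (padic_class s) (padic_class t)"
  using tendsto_padic_abs[OF diff_Cauchy[OF assms]] assms
  by (simp add: padic_dist_def padic_class_diff padic_class_in_carrier)


section \<open>The \<open>p\<close>-adic ultrametric\<close>

lemma carrier_padic_fieldE:
  assumes "x \<in> carrier (padic_field p)"
  obtains s where "s \<in> padic_Cauchy_seqs p" "x = padic_class s"
  using assms unfolding carrier_padic_field[OF prime_p] by blast

lemma padic_dist_commute: "padic_dist p x y = padic_dist p y x"
proof (cases "x \<in> carrier (padic_field p) \<and> y \<in> carrier (padic_field p)")
  case True
  then obtain s t where s: "s \<in> padic_Cauchy_seqs p" "x = padic_class s"
    and t: "t \<in> padic_Cauchy_seqs p" "y = padic_class t"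
    by (meson carrier_padic_fieldE)
  have "(\<lambda>n. rat_padic_abs p (s n - t n)) \<longlonglongrightarrow> padic_dist p y x"
    using tendsto_padic_dist[OF t(1) s(1)]
    by (subst rat_padic_abs_diff_commute[OF prime_p]) (simp add: s t)
  then show ?thesis using tendsto_padic_dist[OF s(1) t(1)] LIMSEQ_unique s t by blast
next
  case False
  then show ?thesis by (auto simp: padic_dist_def)
qed

lemma padic_dist_ultra:
  assumes "x \<in> carrier (padic_field p)" "y \<in> carrier (padic_field p)"
    "z \<in> carrier (padic_field p)"
  shows "padic_dist p x z \<le> max (padic_dist p x y) (padic_dist p y z)"
proof -
  obtain s t u where s: "s \<in> padic_Cauchy_seqs p" "x = padic_class s"
    and t: "t \<in> padic_Cauchy_seqs p" "y = padic_class t"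
    and u: "u \<in> padic_Cauchy_seqs p" "z = padic_class u"
    using assms by (meson carrier_padic_fieldE)
  have "rat_padic_abs p (s n - u n)
        \<le> max (rat_padic_abs p (s n - t n)) (rat_padic_abs p (t n - u n))" for n
    using rat_padic_abs_ultra[OF prime_p, of "s n - t n" "t n - u n"] by simp
  then show ?thesis unfolding s u t
    using tendsto_max[OF tendsto_padic_dist[OF s(1) t(1)] tendsto_padic_dist[OF t(1) u(1)]]
      tendsto_padic_dist[OF s(1) u(1)]
    by (blast intro: LIMSEQ_le)
qed

lemma padic_dist_cases:
  obtains "padic_dist p x y = 0" | k :: int where "padic_dist p x y = real p powi k"
  unfolding padic_dist_def padic_abs_def by metis

lemma padic_dist_eq_0_iff:
  assumes "x \<in> carrier (padic_field p)" "y \<in> carrier (padic_field p)"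
  shows "padic_dist p x y = 0 \<longleftrightarrow> x = y"
proof -
  interpret field "padic_field p" by (rule field_padic_field[OF prime_p])
  have "padic_abs p z = 0 \<longleftrightarrow> z = \<zero>\<^bsub>padic_field p\<^esub>" for z
    using p_gt_1[OF prime_p] by (simp add: padic_abs_def)
  moreover have "x \<ominus>\<^bsub>padic_field p\<^esub> y = \<zero>\<^bsub>padic_field p\<^esub> \<longleftrightarrow> x = y"
    using assms by (metis a_inv_closed minus_eq minus_equality minus_minus r_neg)
  ultimately show ?thesis using assms by (simp add: padic_dist_def)
qed

lemma padic_dist_of_rat:
  "padic_dist p (padic_class (\<lambda>_. q)) (padic_class (\<lambda>_. r)) = rat_padic_abs p (q - r)"
  using tendsto_padic_dist[OF const_Cauchy[OF prime_p] const_Cauchy[OF prime_p], of q r]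
  by (simp add: LIMSEQ_const_iff)

lemma rat_padic_abs_powi: "rat_padic_abs p (of_nat p powi k) = real p powi (- k)"
proof -
  have p0: "p \<noteq> 0" "\<not> is_unit (int p)" using prime_p by auto
  define a where "a = nat k"
  define b where "b = nat (- k)"
  have eq: "(of_nat p powi k :: rat) = of_int (int p ^ a) / of_int (int p ^ b)"
    unfolding a_def b_def by (cases "k \<ge> 0") (auto simp: power_int_def divide_simps)
  have "rat_ord p (of_nat p powi k) = int a - int b"
    unfolding eq by (subst rat_ord_divide[OF prime_p]) (use p0 in \<open>simp_all add: multiplicity_same_power\<close>)
  then have "rat_ord p (of_nat p powi k) = k" by (simp add: a_def b_def)
  then show ?thesis using p0 by (simp add: rat_padic_abs_def)
qed

text \<open>
  The triangle \<open>0\<close>, \<open>p\<^sup>-\<^sup>n\<close>, \<open>p\<^sup>-\<^sup>n + p\<^sup>-\<^sup>m\<close>: the term of smaller absolute value does not change the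
  absolute value of the sum.
\<close>

lemma isosceles_padic_triangle:
  fixes m n :: int
  assumes "m < n"
  obtains x y z where "{x, y, z} \<subseteq> carrier (padic_field p)"
    "padic_dist p x y = real p powi n" "padic_dist p x z = real p powi n"
    "padic_dist p y z = real p powi m"
proof
  define q r :: rat where "q = of_nat p powi (- n)" and "r = of_nat p powi (- m)"
  have abs_q: "rat_padic_abs p q = real p powi n" and abs_r: "rat_padic_abs p r = real p powi m"
    unfolding q_def r_def rat_padic_abs_powi by simp_all
  have "rat_padic_abs p r < rat_padic_abs p q"
    unfolding abs_q abs_r using assms p_gt_1[OF prime_p] by (rule power_int_strict_increasing)
  then have abs_qr: "rat_padic_abs p (q + r) = rat_padic_abs p q"
    by (rule rat_padic_abs_add_eq[OF prime_p])
  show "{padic_class (\<lambda>_. 0), padic_class (\<lambda>_. q), padic_class (\<lambda>_. q + r)}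
        \<subseteq> carrier (padic_field p)"
    using const_Cauchy[OF prime_p] padic_class_in_carrier by blast
  show "padic_dist p (padic_class (\<lambda>_. 0)) (padic_class (\<lambda>_. q)) = real p powi n"
    using abs_q by (simp add: padic_dist_of_rat rat_padic_abs_minus[OF prime_p])
  show "padic_dist p (padic_class (\<lambda>_. 0)) (padic_class (\<lambda>_. q + r)) = real p powi n"
    using abs_q abs_qr rat_padic_abs_minus[OF prime_p, of "q + r"] by (simp add: padic_dist_of_rat)
  show "padic_dist p (padic_class (\<lambda>_. q)) (padic_class (\<lambda>_. q + r)) = real p powi m"
    using abs_r by (simp add: padic_dist_of_rat rat_padic_abs_minus[OF prime_p])
qed


section \<open>Metric preserving functions\<close>

text \<open>
  Both claims come from an isosceles triangle with base \<open>p\<^sup>m\<close> and legs \<open>p\<^sup>n\<close>: the ends of the base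
  are distinct, and the path from one to the other through the apex runs along the two legs.
\<close>

lemma padic_metric_preservingD:
  fixes m n :: int
  assumes pres: "padic_metric_preserving p f" and "m < n"
  shows "0 < f (real p powi m)" "f (real p powi m) \<le> 2 * f (real p powi n)"
proof -
  interpret Metric_space "carrier (padic_field p)" "\<lambda>x y. f (padic_dist p x y)"
    using pres unfolding padic_metric_preserving_def .
  obtain x y z where carr: "{x, y, z} \<subseteq> carrier (padic_field p)"
    and d: "padic_dist p x y = real p powi n" "padic_dist p x z = real p powi n"
      "padic_dist p y z = real p powi m"
    using isosceles_padic_triangle[OF \<open>m < n\<close>] by blast
  have "y \<noteq> z"
    using carr d(3) padic_dist_eq_0_iff[of y z] p_gt_1[OF prime_p] by auto
  then show "0 < f (real p powi m)"
    using carr d(3) zero[of y z] nonneg[of y z] by simp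
  show "f (real p powi m) \<le> 2 * f (real p powi n)"
    using carr d triangle[of y x z] padic_dist_commute[of y x] by simp
qed

lemma padic_metric_preserving_zero:
  assumes "padic_metric_preserving p f"
  shows "f 0 = 0"
proof -
  interpret Metric_space "carrier (padic_field p)" "\<lambda>x y. f (padic_dist p x y)"
    using assms unfolding padic_metric_preserving_def .
  have c: "padic_class (\<lambda>_. 0) \<in> carrier (padic_field p)"
    by (intro padic_class_in_carrier const_Cauchy prime_p)
  show ?thesis using zero[OF c c] padic_dist_eq_0_iff[OF c c] by simp
qed

lemma padic_metric_preservingI:
  assumes nonneg: "f \<in> {0..} \<rightarrow> {0..}" and f0: "f 0 = 0"
    and pos: "\<And>k :: int. 0 < f (real p powi k)"
    and le: "\<And>m n :: int. m < n \<Longrightarrow> f (real p powi m) \<le> 2 * f (real p powi n)"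
  shows "padic_metric_preserving p f"
proof -
  let ?d = "padic_dist p"
  have p1: "real p > 1" by (rule p_gt_1[OF prime_p])
  have d_nonneg: "?d x y \<ge> 0" for x y
    using p1 by (cases rule: padic_dist_cases[of x y]) auto
  have fd_nonneg: "f (?d x y) \<ge> 0" for x y
    using nonneg d_nonneg[of x y] by auto
  show ?thesis unfolding padic_metric_preserving_def
  proof
    show "0 \<le> f (?d x y)" for x y by (rule fd_nonneg)
    show "f (?d x y) = f (?d y x)" for x y by (simp add: padic_dist_commute)
  next
    fix x y assume xy: "x \<in> carrier (padic_field p)" "y \<in> carrier (padic_field p)"
    have "f (?d x y) = 0 \<longleftrightarrow> ?d x y = 0"
      using f0 pos p1 by (cases rule: padic_dist_cases[of x y]) (auto simp: less_le)
    then show "f (?d x y) = 0 \<longleftrightarrow> x = y" using padic_dist_eq_0_iff[OF xy] by simp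
  next
    fix x y z
    assume carr: "x \<in> carrier (padic_field p)" "y \<in> carrier (padic_field p)"
      "z \<in> carrier (padic_field p)"
    have ultra: "?d x z \<le> max (?d x y) (?d y z)" "?d x y \<le> max (?d x z) (?d y z)"
      "?d y z \<le> max (?d x y) (?d x z)"
      using padic_dist_ultra[OF carr] padic_dist_ultra[OF carr(1,3,2)]
        padic_dist_ultra[OF carr(2,1,3)]
      by (simp_all add: padic_dist_commute[of z y] padic_dist_commute[of y x])
    \<comment> \<open>The side \<open>xz\<close> is either a leg, or the base and shorter than the legs.\<close>
    then consider "?d x z = ?d x y" | "?d x z = ?d y z"
      | "?d x y = ?d y z" "?d x z < ?d x y"
      by linarith
    then show "f (?d x z) \<le> f (?d x y) + f (?d y z)"
    proof cases
      case 3
      have "f (?d x z) \<le> 2 * f (?d x y)"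
      proof (cases rule: padic_dist_cases[of x z])
        case 1
        then show ?thesis using f0 fd_nonneg[of x y] by simp
      next
        case (2 m)
        have "?d x y \<noteq> 0" using 3(2) d_nonneg[of x z] by linarith
        then obtain n where n: "?d x y = real p powi n"
          using padic_dist_cases[of x y] by blast
        have "m < n"
          using 3(2) power_int_increasing[of n m "real p"] p1 unfolding 2 n by force
        then show ?thesis unfolding 2 n by (rule le)
      qed
      then show ?thesis using 3(1) by simp
    qed (use fd_nonneg[of x y] fd_nonneg[of y z] in auto)
  qed
qed

end

theorem proposition4p4:
  fixes p :: nat and f :: "real \<Rightarrow> real"
  assumes "prime p"
    and "f \<in> {0..} \<rightarrow> {0..}"
  shows "(f 0 = 0 \<and>
          (\<forall>m n :: int. m < n \<longrightarrow>
             0 < f (real p powi m) \<and> f (real p powi m) \<le> 2 * f (real p powi n)))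
         \<longleftrightarrow> padic_metric_preserving p f"
  (is "?powers \<longleftrightarrow> _")
proof
  assume powers: ?powers
  show "padic_metric_preserving p f"
  proof (rule padic_metric_preservingI[OF assms])
    show "0 < f (real p powi k)" for k :: int
      using powers[THEN conjunct2, rule_format, of k "k + 1"] by simp
  qed (use powers in auto)
next
  assume "padic_metric_preserving p f"
  then show ?powers
    using padic_metric_preservingD[OF assms(1)] padic_metric_preserving_zero[OF assms(1)] by blast
qed

end
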